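(* Let $H=(\sigma,\alpha)$ be a connected orientable hypermap with dart set $D$, let $M(H)$ be its medial map with its canonical checkerboard coloring, and let $E'\subseteq E(H)$ be a set of hyperedges. The following are equivalent: (1) The partial dual $H^{E'}$ is bipartite. (2) There exists an all-crossing direction $\Phi$ of $M(H)$ such that $E'=C(\Phi)$, where $C(\Phi)$ denotes the set of all type-$c$ hyperedges.
   Context: Permutations are composed from right to left. A connected orientable hypermap is a pair $H=(\sigma,\alpha)$ of permutations of a finite set $D=\{1,\dots,n\}$ of darts such that the group generated by $\sigma,\alpha$ acts transitively on $D$. Vertices are the cycles of $\sigma$ and hyperedges are the cycles of $\alpha$ (fixed points count as cycles of length 1); $E(H)$ is the set of hyperedges. For a dart $i$, $v(i)$ is the $\sigma$-cycle containing $i$. $H$ is bipartite if its vertex-adjacency graph $\Gamma(H)$ is bipartite (2-colorable), where $\Gamma(H)$ has the vertices of $H$ as vertices and, for each dart $i\in D$, an edge joining $v(i)$ to $v(\alpha(i))$ (loops and multiple edges allowed; a loop prevents bipartiteness). Partial dual. For $E'\subseteq E(H)$, let $\alpha_{E'}$ be the product of the $\alpha$-cycles in $E'$ and $\alpha_{\overline{E'}}$ the product of the remaining $\alpha$-cycles. The partial dual is the hypermap $H^{E'}=(\sigma^{E'},\alpha^{E'})$ with vertex permutation $\sigma^{E'}=\alpha_{E'}^{-1}\sigma$ and hyperedge permutation $\alpha^{E'}=\alpha_{E'}^{-1}\alpha_{\overline{E'}}$. Medial map. Let $D^{\pm}=\{i^-,i^+: i\in D\}$ (the half-edges of $M(H)$).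 The medial map $M(H)=(\sigma_M,\alpha_M)$ has one vertex $v_e$ for each hyperedge $e=(i_1\,i_2\cdots i_k)$, with cyclic order of half-edges $(i_1^-\,i_1^+\,i_2^-\,i_2^+\cdots i_k^-\,i_k^+)$ (these are the cycles of $\sigma_M$), and one edge $m_i$ for each dart $i\in D$, with two ends $i^+$ and $\sigma(i)^-$ (so $\alpha_M=\prod_{i\in D}(i^+\,\sigma(i)^-)$). In the canonical checkerboard coloring of the faces of $M(H)$, the corners at $v_e$ are alternately black and white: the black corners are the pairs $(i_j^-,i_j^+)$ and the white corners are the pairs $(i_j^+,i_{j+1}^-)$, $1\le j\le k$, with $i_{k+1}:=i_1$. Directions. A direction (orientation) of $M(H)$ chooses for every edge one end as tail and the other as head; a half-edge at a vertex is directed out of the vertex if it is the tail and into the vertex if it is the head of its edge. A corner is a source/sink corner if its two half-edges are both directed into the vertex or both directed out of it; otherwise it is a crossing corner. A direction is all-crossing if at every vertex exactly one of the following holds: (i) all black corners are source/sink corners and all white corners are crossing corners (the vertex is then called type-$c$); (ii) all white corners are source/sink corners and all black corners are crossing corners (type-$d$). For an all-crossing direction $\Phi$, a hyperedge $e$ is type-$c$ if $v_e$ is type-$c$, and $C(\Phi)$ is the set of type-$c$ hyperedges of $H$. *)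

theory Defs
  imports "HOL-Algebra.Sym_Groups" "HOL-Combinatorics.Orbits" "Graph_Theory.Digraph"
begin

section \<open>Hypermaps\<close>

text \<open>A pair \<open>(\<sigma>, \<alpha>)\<close>; the set of darts is carried separately.\<close>

type_synonym 'd hypermap = "('d \<Rightarrow> 'd) \<times> ('d \<Rightarrow> 'd)"

definition connected_hypermap :: "nat \<Rightarrow> nat hypermap \<Rightarrow> bool" where
  "connected_hypermap n H \<longleftrightarrow>
     fst H permutes {1..n} \<and> snd H permutes {1..n} \<and>
     (\<forall>i\<in>{1..n}. \<forall>j\<in>{1..n}. \<exists>g \<in> generate (sym_group n) {fst H, snd H}. g i = j)"

text \<open>A cycle of a permutation \<open>f\<close> is identified with its set of darts, from which the cycle as
  a permutation is recovered as \<open>perm_restrict f c\<close>.\<close>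

definition cycle_sets :: "('d \<Rightarrow> 'd) \<Rightarrow> 'd set \<Rightarrow> 'd set set" where
  "cycle_sets f S = orbit f ` S"

definition vertices :: "nat \<Rightarrow> nat hypermap \<Rightarrow> nat set set" where
  "vertices n H = cycle_sets (fst H) {1..n}"

definition hyperedges :: "nat \<Rightarrow> nat hypermap \<Rightarrow> nat set set" where
  "hyperedges n H = cycle_sets (snd H) {1..n}"

definition vertex_of :: "nat hypermap \<Rightarrow> nat \<Rightarrow> nat set" where
  "vertex_of H i = orbit (fst H) i"

text \<open>The digraph record serves as a multigraph with loops; the orientation of the arc of a dart
  \<open>i\<close>, from \<open>v(i)\<close> to \<open>v(\<alpha>(i))\<close>, plays no role in \<open>two_colorable\<close>.\<close>

definition adjacency_graph :: "nat \<Rightarrow> nat hypermap \<Rightarrow> (nat set, nat) pre_digraph" where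
  "adjacency_graph n H =
     \<lparr> verts = vertices n H, arcs = {1..n},
       tail = vertex_of H, head = (\<lambda>i. vertex_of H (snd H i)) \<rparr>"

definition two_colorable :: "('v, 'e) pre_digraph \<Rightarrow> bool" where
  "two_colorable G \<longleftrightarrow> (\<exists>c :: 'v \<Rightarrow> bool. \<forall>a\<in>arcs G. c (tail G a) \<noteq> c (head G a))"

definition bipartite :: "nat \<Rightarrow> nat hypermap \<Rightarrow> bool" where
  "bipartite n H \<longleftrightarrow> two_colorable (adjacency_graph n H)"

section \<open>Partial duals\<close>

text \<open>The product of the cycles of \<open>f\<close> in \<open>C\<close>. Distinct cycles commute, so the fold does not
  depend on the order; see \<open>cycle_product_eq\<close>.\<close>

definition cycle_product :: "('d \<Rightarrow> 'd) \<Rightarrow> 'd set set \<Rightarrow> 'd \<Rightarrow> 'd" where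
  "cycle_product f C = Finite_Set.fold (\<lambda>c p. perm_restrict f c \<circ> p) id C"

definition partial_dual :: "nat \<Rightarrow> nat hypermap \<Rightarrow> nat set set \<Rightarrow> nat hypermap" where
  "partial_dual n H E' =
     (let \<sigma> = fst H;
          \<alpha>1 = cycle_product (snd H) E';
          \<alpha>2 = cycle_product (snd H) (hyperedges n H - E')
      in (inv' \<alpha>1 \<circ> \<sigma>, inv' \<alpha>1 \<circ> \<alpha>2))"

lemma cycle_sets_disjoint:
  assumes "f permutes S" "finite S" "c \<in> cycle_sets f S" "d \<in> cycle_sets f S" "c \<noteq> d"
  shows "c \<inter> d = {}"
proof (rule ccontr)
  assume "c \<inter> d \<noteq> {}"
  then obtain z where z: "z \<in> c" "z \<in> d" by blast
  have perm: "permutation f" using assms(1,2) by (auto simp: permutation_permutes)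
  obtain x y where "c = orbit f x" "d = orbit f y"
    using assms(3,4) by (auto simp: cycle_sets_def)
  then have "orbit f z = c" "orbit f z = d"
    using z orbit_cyclic_eq3[OF cyclic_on_orbit'[OF perm]] by blast+
  with assms(5) show False by simp
qed

lemma cycle_sets_closed:
  assumes "f permutes S" "finite S" "c \<in> cycle_sets f S" "x \<in> c"
  shows "f x \<in> c"
  using assms by (auto simp: cycle_sets_def intro: orbit.step)

lemma cycle_product_eq:
  assumes f: "f permutes S" "finite S" and C: "C \<subseteq> cycle_sets f S"
  shows "cycle_product f C = perm_restrict f (\<Union>C)"
proof -
  let ?F = "\<lambda>c p. perm_restrict f c \<circ> p"
  have com: "perm_restrict f c (perm_restrict f d x) = perm_restrict f d (perm_restrict f c x)"
    if "c \<in> cycle_sets f S" "d \<in> cycle_sets f S" for c d x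
  proof (cases "c = d")
    case False
    then have "c \<inter> d = {}" using cycle_sets_disjoint f that by blast
    moreover have "x \<in> c \<Longrightarrow> f x \<in> c" "x \<in> d \<Longrightarrow> f x \<in> d"
      using cycle_sets_closed[OF f] that by blast+
    ultimately show ?thesis by (auto simp: perm_restrict_def)
  qed simp
  interpret comp_fun_commute_on "cycle_sets f S" ?F
    by unfold_locales ((rule ext)+, simp only: comp_apply com)
  have "finite C" using C f(2) by (metis cycle_sets_def finite_imageI finite_subset)
  then show ?thesis
    using C
  proof (induction C rule: finite_induct)
    case empty
    then show ?case by (simp add: cycle_product_def perm_restrict_def fun_eq_iff)
  next
    case (insert c C)
    have "cycle_product f (insert c C) = perm_restrict f c \<circ> cycle_product f C"
      unfolding cycle_product_def using insert by (intro fold_insert) auto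
    also have "\<dots> = perm_restrict f c \<circ> perm_restrict f (\<Union>C)" using insert by simp
    also have "\<dots> = perm_restrict f (\<Union>(insert c C))"
    proof
      fix x
      have disj: "c \<inter> d = {}" if "d \<in> C" for d
        using cycle_sets_disjoint[OF f, of c d] insert that by auto
      show "(perm_restrict f c \<circ> perm_restrict f (\<Union>C)) x = perm_restrict f (\<Union>(insert c C)) x"
      proof (cases "x \<in> \<Union>C")
        case True
        then obtain d where d: "d \<in> C" "x \<in> d" by blast
        then have "f x \<in> d" using cycle_sets_closed[OF f] insert.prems by blast
        then have "f x \<notin> c" using disj d by blast
        with True show ?thesis by (simp add: perm_restrict_def)
      qed (auto simp: perm_restrict_def)
    qed
    finally show ?case .
  qed
qed

section \<open>The medial map\<close>

datatype half_edge = Minus nat | Plus nat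

definition half_edges :: "nat \<Rightarrow> half_edge set" where
  "half_edges n = Minus ` {1..n} \<union> Plus ` {1..n}"

text \<open>In a cycle \<open>(i\<^sub>1 \<dots> i\<^sub>k)\<close> of \<open>\<alpha>\<close> the successor of \<open>i\<^sub>j\<close> is \<open>\<alpha>(i\<^sub>j)\<close>, whence the
  vertex permutation below.\<close>

definition medial_map :: "nat \<Rightarrow> nat hypermap \<Rightarrow> half_edge hypermap" where
  "medial_map n H =
     ((\<lambda>h. if h \<in> half_edges n
           then (case h of Minus i \<Rightarrow> Plus i | Plus i \<Rightarrow> Minus (snd H i)) else h),
      (\<lambda>h. if h \<in> half_edges n
           then (case h of Plus i \<Rightarrow> Minus (fst H i) | Minus j \<Rightarrow> Plus (inv' (fst H) j)) else h))"

definition medial_vertices :: "nat \<Rightarrow> nat hypermap \<Rightarrow> half_edge set set" where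
  "medial_vertices n H = cycle_sets (fst (medial_map n H)) (half_edges n)"

definition medial_edges :: "nat \<Rightarrow> nat hypermap \<Rightarrow> half_edge set set" where
  "medial_edges n H = cycle_sets (snd (medial_map n H)) (half_edges n)"

text \<open>The vertex \<open>v\<^sub>e\<close> of a hyperedge \<open>e\<close>.\<close>

definition medial_vertex :: "nat set \<Rightarrow> half_edge set" where
  "medial_vertex e = Minus ` e \<union> Plus ` e"

text \<open>A corner at a vertex is an ordered pair of cyclically consecutive half-edges. (At a vertex of
  degree two the black and the white corner differ only in this order.)\<close>

definition black_corners :: "nat \<Rightarrow> nat hypermap \<Rightarrow> half_edge set \<Rightarrow> (half_edge \<times> half_edge) set"
  where "black_corners n H v = {(h, fst (medial_map n H) h) | h. h \<in> v \<and> h \<in> range Minus}"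

definition white_corners :: "nat \<Rightarrow> nat hypermap \<Rightarrow> half_edge set \<Rightarrow> (half_edge \<times> half_edge) set"
  where "white_corners n H v = {(h, fst (medial_map n H) h) | h. h \<in> v \<and> h \<in> range Plus}"

lemma half_edges_iff [simp]:
  "Minus i \<in> half_edges n \<longleftrightarrow> i \<in> {1..n}" "Plus i \<in> half_edges n \<longleftrightarrow> i \<in> {1..n}"
  by (auto simp: half_edges_def)

context
  fixes n :: nat and H :: "nat hypermap"
  assumes H: "connected_hypermap n H"
begin

private lemma perms: "fst H permutes {1..n}" "snd H permutes {1..n}"
  using H by (auto simp: connected_hypermap_def)

private lemma img:
  "fst H i \<in> {1..n} \<longleftrightarrow> i \<in> {1..n}" "snd H i \<in> {1..n} \<longleftrightarrow> i \<in> {1..n}"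
  "inv' (fst H) i \<in> {1..n} \<longleftrightarrow> i \<in> {1..n}"
  using perms permutes_in_image permutes_inv by metis+

private lemma inj:
  "snd H i = snd H j \<longleftrightarrow> i = j" "fst H i = fst H j \<longleftrightarrow> i = j"
  "inv' (fst H) i = inv' (fst H) j \<longleftrightarrow> i = j"
  using perms by (metis permutes_inv permutes_inj inj_eq)+

private lemma med:
  "i \<in> {1..n} \<Longrightarrow> fst (medial_map n H) (Minus i) = Plus i"
  "i \<in> {1..n} \<Longrightarrow> fst (medial_map n H) (Plus i) = Minus (snd H i)"
  "i \<in> {1..n} \<Longrightarrow> snd (medial_map n H) (Plus i) = Minus (fst H i)"
  "i \<in> {1..n} \<Longrightarrow> snd (medial_map n H) (Minus i) = Plus (inv' (fst H) i)"
  by (simp_all add: medial_map_def)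

lemma medial_map_permutes:
  "fst (medial_map n H) permutes half_edges n" "snd (medial_map n H) permutes half_edges n"
proof -
  have fin: "finite (half_edges n)" by (simp add: half_edges_def)
  show "fst (medial_map n H) permutes half_edges n"
  proof (rule inj_imp_permutes)
    show "inj_on (fst (medial_map n H)) (half_edges n)"
      by (auto simp: inj_on_def medial_map_def inj split: half_edge.splits)
    show "fst (medial_map n H) h \<in> half_edges n" if "h \<in> half_edges n" for h
      using that img by (cases h) (simp_all add: medial_map_def del: atLeastAtMost_iff)
    show "fst (medial_map n H) h = h" if "h \<notin> half_edges n" for h
      using that by (simp add: medial_map_def)
  qed (fact fin)
  show "snd (medial_map n H) permutes half_edges n"
  proof (rule inj_imp_permutes)
    show "inj_on (snd (medial_map n H)) (half_edges n)"
      by (auto simp: inj_on_def medial_map_def inj split: half_edge.splits)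
    show "snd (medial_map n H) h \<in> half_edges n" if "h \<in> half_edges n" for h
      using that img by (cases h) (simp_all add: medial_map_def del: atLeastAtMost_iff)
    show "snd (medial_map n H) h = h" if "h \<notin> half_edges n" for h
      using that by (simp add: medial_map_def)
  qed (fact fin)
qed

private lemma med_orbit_self:
  "h \<in> orbit (fst (medial_map n H)) h" "h \<in> orbit (snd (medial_map n H)) h"
proof -
  have "finite (half_edges n)" by (simp add: half_edges_def)
  then have "permutation (fst (medial_map n H))" "permutation (snd (medial_map n H))"
    using medial_map_permutes by (auto simp: permutation_permutes)
  then show "h \<in> orbit (fst (medial_map n H)) h" "h \<in> orbit (snd (medial_map n H)) h"
    by (simp_all add: permutation_self_in_orbit)
qed

lemma medial_edges_eq: "medial_edges n H = (\<lambda>i. {Plus i, Minus (fst H i)}) ` {1..n}"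
proof -
  let ?f = "snd (medial_map n H)"
  have inv: "inv' (fst H) (fst H i) = i" "fst H (inv' (fst H) i) = i" for i
    using permutes_inverses perms by metis+
  have orb: "orbit ?f h = {h, ?f h}" if h: "h \<in> half_edges n" for h
  proof
    have invol: "?f (?f h) = h"
      using h img inv by (cases h) (simp_all add: med del: atLeastAtMost_iff)
    show "orbit ?f h \<subseteq> {h, ?f h}"
    proof
      fix k assume "k \<in> orbit ?f h"
      then show "k \<in> {h, ?f h}" by induction (auto simp: invol)
    qed
    show "{h, ?f h} \<subseteq> orbit ?f h" using med_orbit_self(2) by (auto intro: orbit.base)
  qed
  have P: "orbit ?f (Plus i) = {Plus i, Minus (fst H i)}" if "i \<in> {1..n}" for i
    using orb[of "Plus i"] that by (simp add: med del: atLeastAtMost_iff)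
  have M: "orbit ?f (Minus i) = {Plus (inv' (fst H) i), Minus (fst H (inv' (fst H) i))}"
    if "i \<in> {1..n}" for i
    using orb[of "Minus i"] that by (simp add: med inv insert_commute del: atLeastAtMost_iff)
  show ?thesis
    unfolding medial_edges_def cycle_sets_def half_edges_def image_Un image_image
  proof (intro equalityI subsetI)
    fix x
    assume "x \<in> (\<lambda>i. orbit ?f (Minus i)) ` {1..n} \<union> (\<lambda>i. orbit ?f (Plus i)) ` {1..n}"
    then show "x \<in> (\<lambda>i. {Plus i, Minus (fst H i)}) ` {1..n}"
      using P M img(3) by (metis (no_types, lifting) UnE image_iff)
  next
    fix x
    assume "x \<in> (\<lambda>i. {Plus i, Minus (fst H i)}) ` {1..n}"
    then show "x \<in> (\<lambda>i. orbit ?f (Minus i)) ` {1..n} \<union> (\<lambda>i. orbit ?f (Plus i)) ` {1..n}"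
      using P by auto
  qed
qed

lemma medial_vertices_eq: "medial_vertices n H = medial_vertex ` hyperedges n H"
proof -
  let ?f = "fst (medial_map n H)" and ?a = "snd H"
  have a_perm: "permutation ?a" using perms(2) by (auto simp: permutation_permutes)
  have "finite (half_edges n)" by (simp add: half_edges_def)
  then have f_perm: "permutation ?f" using medial_map_permutes by (auto simp: permutation_permutes)
  have self: "i \<in> orbit ?a i" for i using a_perm by (simp add: permutation_self_in_orbit)
  have sub: "j \<in> {1..n}" if "j \<in> orbit ?a i" "i \<in> {1..n}" for i j
    using that permutes_orbit_subset[OF perms(2)] by blast
  have up: "Plus j \<in> orbit ?f h" if "Minus j \<in> orbit ?f h" "j \<in> {1..n}" for j h
    using orbit.step[OF that(1)] that(2) by (simp add: med del: atLeastAtMost_iff)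
  have nxt: "Minus (?a j) \<in> orbit ?f h" if "Plus j \<in> orbit ?f h" "j \<in> {1..n}" for j h
    using orbit.step[OF that(1)] that(2) by (simp add: med del: atLeastAtMost_iff)
  have M: "orbit ?f (Minus i) = medial_vertex (orbit ?a i)" if i: "i \<in> {1..n}" for i
  proof
    show "orbit ?f (Minus i) \<subseteq> medial_vertex (orbit ?a i)"
    proof
      fix k assume "k \<in> orbit ?f (Minus i)"
      then show "k \<in> medial_vertex (orbit ?a i)"
      proof induction
        case base
        then show ?case using i self by (simp add: med medial_vertex_def del: atLeastAtMost_iff)
      next
        case (step k)
        then show ?case
          using sub i by (auto simp: med medial_vertex_def simp del: atLeastAtMost_iff
            intro: orbit.step)
      qed
    qed
    have "Minus j \<in> orbit ?f (Minus i)" if "j \<in> orbit ?a i" for j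
      using that
    proof induction
      case base
      then show ?case using nxt[OF up[OF med_orbit_self(1) i] i] .
    next
      case (step j)
      then show ?case using nxt up sub i by blast
    qed
    then show "medial_vertex (orbit ?a i) \<subseteq> orbit ?f (Minus i)"
      using up sub i by (auto simp: medial_vertex_def simp del: atLeastAtMost_iff)
  qed
  have P: "orbit ?f (Plus i) = orbit ?f (Minus i)" if i: "i \<in> {1..n}" for i
    using orbit_cyclic_eq3[OF cyclic_on_orbit'[OF f_perm]] up[OF med_orbit_self(1) i] by blast
  show ?thesis
    unfolding medial_vertices_def hyperedges_def cycle_sets_def half_edges_def image_Un image_image
    using M P by auto
qed

lemma medial_corners_eq:
  assumes "e \<in> hyperedges n H"
  shows "black_corners n H (medial_vertex e) = {(Minus i, Plus i) | i. i \<in> e}"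
    and "white_corners n H (medial_vertex e) = {(Plus i, Minus (snd H i)) | i. i \<in> e}"
proof -
  have "e \<subseteq> {1..n}"
    using assms permutes_orbit_subset[OF perms(2)] unfolding hyperedges_def cycle_sets_def by blast
  then have D: "i \<in> {1..n}" if "i \<in> e" for i using that by blast
  show "black_corners n H (medial_vertex e) = {(Minus i, Plus i) | i. i \<in> e}"
    using D med(1) by (fastforce simp: black_corners_def medial_vertex_def)
  show "white_corners n H (medial_vertex e) = {(Plus i, Minus (snd H i)) | i. i \<in> e}"
    using D med(2) by (fastforce simp: white_corners_def medial_vertex_def)
qed

end

section \<open>Directions\<close>

text \<open>A direction assigns to every edge of the medial map the pair of its tail and its head.\<close>

type_synonym edge_direction = "half_edge set \<Rightarrow> half_edge \<times> half_edge"

definition direction :: "nat \<Rightarrow> nat hypermap \<Rightarrow> edge_direction \<Rightarrow> bool" where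
  "direction n H \<Phi> \<longleftrightarrow>
     (\<forall>m \<in> medial_edges n H. m = {fst (\<Phi> m), snd (\<Phi> m)} \<and> fst (\<Phi> m) \<noteq> snd (\<Phi> m))"

definition medial_edge_of :: "nat \<Rightarrow> nat hypermap \<Rightarrow> half_edge \<Rightarrow> half_edge set" where
  "medial_edge_of n H h = orbit (snd (medial_map n H)) h"

definition directed_out :: "nat \<Rightarrow> nat hypermap \<Rightarrow> edge_direction \<Rightarrow> half_edge \<Rightarrow> bool" where
  "directed_out n H \<Phi> h \<longleftrightarrow> h = fst (\<Phi> (medial_edge_of n H h))"

definition directed_in :: "nat \<Rightarrow> nat hypermap \<Rightarrow> edge_direction \<Rightarrow> half_edge \<Rightarrow> bool" where
  "directed_in n H \<Phi> h \<longleftrightarrow> h = snd (\<Phi> (medial_edge_of n H h))"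

definition source_sink ::
  "nat \<Rightarrow> nat hypermap \<Rightarrow> edge_direction \<Rightarrow> half_edge \<times> half_edge \<Rightarrow> bool" where
  "source_sink n H \<Phi> c \<longleftrightarrow>
     (directed_in n H \<Phi> (fst c) \<and> directed_in n H \<Phi> (snd c)) \<or>
     (directed_out n H \<Phi> (fst c) \<and> directed_out n H \<Phi> (snd c))"

definition crossing ::
  "nat \<Rightarrow> nat hypermap \<Rightarrow> edge_direction \<Rightarrow> half_edge \<times> half_edge \<Rightarrow> bool" where
  "crossing n H \<Phi> c \<longleftrightarrow> \<not> source_sink n H \<Phi> c"

definition type_c :: "nat \<Rightarrow> nat hypermap \<Rightarrow> edge_direction \<Rightarrow> half_edge set \<Rightarrow> bool" where
  "type_c n H \<Phi> v \<longleftrightarrow>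
     (\<forall>c \<in> black_corners n H v. source_sink n H \<Phi> c) \<and>
     (\<forall>c \<in> white_corners n H v. crossing n H \<Phi> c)"

definition type_d :: "nat \<Rightarrow> nat hypermap \<Rightarrow> edge_direction \<Rightarrow> half_edge set \<Rightarrow> bool" where
  "type_d n H \<Phi> v \<longleftrightarrow>
     (\<forall>c \<in> white_corners n H v. source_sink n H \<Phi> c) \<and>
     (\<forall>c \<in> black_corners n H v. crossing n H \<Phi> c)"

definition all_crossing :: "nat \<Rightarrow> nat hypermap \<Rightarrow> edge_direction \<Rightarrow> bool" where
  "all_crossing n H \<Phi> \<longleftrightarrow>
     direction n H \<Phi> \<and>
     (\<forall>v \<in> medial_vertices n H.
        (type_c n H \<Phi> v \<and> \<not> type_d n H \<Phi> v) \<or> (type_d n H \<Phi> v \<and> \<not> type_c n H \<Phi> v))"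

definition type_c_hyperedges :: "nat \<Rightarrow> nat hypermap \<Rightarrow> edge_direction \<Rightarrow> nat set set" where
  "type_c_hyperedges n H \<Phi> = {e \<in> hyperedges n H. type_c n H \<Phi> (medial_vertex e)}"

end

theory Submission
  imports Defs
begin

text \<open>Both conditions say the same thing about a Boolean function \<open>x\<close> on the darts.

  A direction of the medial map is the same as a function \<open>x\<close>, where \<open>x i\<close> says that the edge
  \<open>m\<^sub>i\<close> leaves its end \<open>i\<^sup>+\<close>; the half-edge \<open>j\<^sup>-\<close>, being the other end of the edge of
  \<open>\<sigma>\<inverse>(j)\<close>, is then directed out exactly if \<open>x (\<sigma>\<inverse>(j))\<close> fails. So the black corner at \<open>i\<close> is a
  source or sink iff \<open>x (\<sigma>\<inverse>(i)) \<noteq> x i\<close>, and the white one iff \<open>x (\<sigma>\<inverse>(\<alpha>(i))) \<noteq> x i\<close>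
  (\<open>type_c_iff\<close>, \<open>type_d_iff\<close>). The direction is all-crossing with type-c set \<open>E'\<close> iff at every
  dart \<open>i\<close> exactly one of these two inequalities holds, namely the first if \<open>i\<close> lies on a hyperedge
  of \<open>E'\<close> and the second otherwise (\<open>all_crossing_iff_corner_conditions\<close>).

  A bipartition of the partial dual is also a function \<open>x\<close> on the darts: it is invariant under
  \<open>\<sigma>\<^sup>E\<^sup>'\<close> and is flipped by \<open>\<alpha>\<^sup>E\<^sup>'\<close> (\<open>bipartite_iff_dart_coloring\<close>). On the darts off \<open>E'\<close> one has
  \<open>\<alpha>\<^sup>E\<^sup>' = \<alpha>\<close>, on \<open>E'\<close> it is \<open>\<alpha>\<inverse>\<close>, and \<open>\<sigma>\<^sup>E\<^sup>'\<close> follows \<open>\<sigma>\<close> by \<open>\<alpha>\<inverse>\<close> whenever \<open>\<sigma>\<close>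
  arrives on \<open>E'\<close>. Rewriting invariance and flipping in terms of \<open>\<sigma>\<inverse>\<close> yields the same local
  conditions, with the same \<open>x\<close> (\<open>dart_coloring_iff_corner_conditions\<close>).\<close>

section \<open>Bipartitions as colorings of darts\<close>

lemma orbit_eq_orbit:
  assumes "permutation f" "j \<in> orbit f i"
  shows "orbit f j = orbit f i"
  using orbit_cyclic_eq3[OF cyclic_on_orbit'[OF assms(1)] assms(2)] .

lemma invariant_on_orbit:
  assumes s: "s permutes S" and x: "\<And>i. i \<in> S \<Longrightarrow> x (s i) = x i"
    and i: "i \<in> S" and j: "j \<in> orbit s i"
  shows "x j = x i"
proof -
  have "j \<in> S \<and> x j = x i"
    using j by induction (use x i permutes_in_image[OF s] in auto)
  then show ?thesis ..
qed

lemma bipartite_iff_dart_coloring: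
  assumes s: "s permutes {1..n}" and a: "a permutes {1..n}"
  shows "bipartite n (s, a) \<longleftrightarrow> (\<exists>x :: nat \<Rightarrow> bool. \<forall>i\<in>{1..n}. x (s i) = x i \<and> x (a i) \<noteq> x i)"
    (is "?L \<longleftrightarrow> ?R")
proof -
  have perm: "permutation s" using s by (auto simp: permutation_permutes)
  then have self: "i \<in> orbit s i" for i by (rule permutation_self_in_orbit)
  have bip: "?L \<longleftrightarrow> (\<exists>c :: nat set \<Rightarrow> bool. \<forall>i\<in>{1..n}. c (orbit s i) \<noteq> c (orbit s (a i)))"
    by (simp add: bipartite_def two_colorable_def adjacency_graph_def vertex_of_def)
  show ?thesis
  proof
    assume ?L
    then have "\<exists>c :: nat set \<Rightarrow> bool. \<forall>i\<in>{1..n}. c (orbit s i) \<noteq> c (orbit s (a i))"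
      by (simp only: bip)
    then obtain c :: "nat set \<Rightarrow> bool"
      where c: "\<forall>i\<in>{1..n}. c (orbit s i) \<noteq> c (orbit s (a i))" ..
    have "orbit s (s i) = orbit s i" for i by (rule orbit_eq_orbit[OF perm orbit.base])
    with c have "\<forall>i\<in>{1..n}. c (orbit s (s i)) = c (orbit s i) \<and> c (orbit s (a i)) \<noteq> c (orbit s i)"
      by metis
    then show ?R by (intro exI[of _ "\<lambda>i. c (orbit s i)"])
  next
    assume ?R
    then obtain x :: "nat \<Rightarrow> bool"
      where x_all: "\<forall>i\<in>{1..n}. x (s i) = x i \<and> x (a i) \<noteq> x i" ..
    have x: "x (s i) = x i" if "i \<in> {1..n}" for i using bspec[OF x_all that] ..
    have flip: "x (a i) \<noteq> x i" if "i \<in> {1..n}" for i using bspec[OF x_all that] ..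
    \<comment> \<open>As \<open>x\<close> is constant on vertices, the existential quantifier just picks its value there.\<close>
    have const: "(\<exists>j\<in>orbit s i. x j) = x i" if "i \<in> {1..n}" for i
      using invariant_on_orbit[where x = x, OF s x that] self by blast
    have "a i \<in> {1..n}" if "i \<in> {1..n}" for i using that permutes_in_image[OF a] by blast
    then have "\<forall>i\<in>{1..n}. (\<exists>j\<in>orbit s i. x j) \<noteq> (\<exists>j\<in>orbit s (a i). x j)"
      using const flip by simp
    then show ?L
      unfolding bip by (intro exI[of _ "\<lambda>v. \<exists>j\<in>v. x j"])
  qed
qed

section \<open>Partial duals\<close>

lemma mem_Union_cycle_sets_iff:
  assumes f: "f permutes S" "finite S" and C: "C \<subseteq> cycle_sets f S"
  shows "i \<in> \<Union>C \<longleftrightarrow> orbit f i \<in> C \<and> i \<in> S"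
proof -
  have perm: "permutation f" using f by (auto simp: permutation_permutes)
  have "orbit f i = c \<and> i \<in> S" if c: "c \<in> C" "i \<in> c" for c
  proof -
    obtain j where j: "j \<in> S" "c = orbit f j" using c C by (auto simp: cycle_sets_def)
    then show ?thesis
      using c orbit_eq_orbit[OF perm] permutes_orbit_subset[OF f(1)]
      by blast
  qed
  then show ?thesis using permutation_self_in_orbit[OF perm] by blast
qed

lemma Union_cycle_sets_closed_iff:
  assumes f: "f permutes S" "finite S" and C: "C \<subseteq> cycle_sets f S"
  shows "f i \<in> \<Union>C \<longleftrightarrow> i \<in> \<Union>C"
proof -
  have "permutation f" using f by (auto simp: permutation_permutes)
  then have "orbit f (f i) = orbit f i" by (rule orbit_eq_orbit[OF _ orbit.base])
  then show ?thesis
    using mem_Union_cycle_sets_iff[OF assms] permutes_in_image[OF f(1)] by simp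
qed

lemma perm_restrict_permutes:
  assumes f: "f permutes S" and A: "\<And>i. i \<in> S \<Longrightarrow> f i \<in> A \<longleftrightarrow> i \<in> A"
  shows "perm_restrict f A permutes S"
proof (rule bij_imp_permutes)
  have "inj_on (perm_restrict f A) S"
  proof (rule inj_onI)
    fix i j assume "i \<in> S" "j \<in> S" "perm_restrict f A i = perm_restrict f A j"
    then show "i = j"
      using A[of i] A[of j] permutes_inj[OF f]
      by (cases "i \<in> A"; cases "j \<in> A") (auto simp: perm_restrict_simps inj_eq)
  qed
  moreover have "perm_restrict f A ` S = S"
  proof
    show "perm_restrict f A ` S \<subseteq> S"
      using permutes_in_image[OF f] by (auto simp: perm_restrict_def)
    have "j \<in> perm_restrict f A ` S" if j: "j \<in> S" for j
    proof (cases "j \<in> A")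
      case True
      obtain i where "i \<in> S" "j = f i" using j permutes_image[OF f] by blast
      then show ?thesis using True A by (auto simp: perm_restrict_def image_iff)
    qed (use j in \<open>auto simp: perm_restrict_def image_iff\<close>)
    then show "S \<subseteq> perm_restrict f A ` S" by blast
  qed
  ultimately show "bij_betw (perm_restrict f A) S S" by (simp add: bij_betw_def)
qed (use permutes_not_in[OF f] in \<open>simp add: perm_restrict_def\<close>)

lemma inv_perm_restrict:
  assumes f: "bij f" and A: "\<And>i. f i \<in> A \<longleftrightarrow> i \<in> A"
  shows "inv' (perm_restrict f A) = perm_restrict (inv' f) A"
proof (rule inv_unique_comp)
  have inv: "f (inv' f i) = i" "inv' f (f i) = i" for i
    using f by (simp_all add: bij_is_surj surj_f_inv_f bij_is_inj)
  then have "inv' f i \<in> A \<longleftrightarrow> i \<in> A" for i using A by metis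
  then show "perm_restrict f A \<circ> perm_restrict (inv' f) A = id"
    and "perm_restrict (inv' f) A \<circ> perm_restrict f A = id"
    using inv A by (auto simp: perm_restrict_def fun_eq_iff)
qed

lemma partial_dual_eq:
  assumes \<alpha>: "\<alpha> permutes {1..n}" and E': "E' \<subseteq> hyperedges n (\<sigma>, \<alpha>)"
  shows "partial_dual n (\<sigma>, \<alpha>) E' =
    (perm_restrict (inv' \<alpha>) (\<Union>E') \<circ> \<sigma>,
     perm_restrict (inv' \<alpha>) (\<Union>E') \<circ> perm_restrict \<alpha> ({1..n} - \<Union>E'))"
proof -
  let ?C = "cycle_sets \<alpha> {1..n}"
  have E: "E' \<subseteq> ?C" using E' by (simp add: hyperedges_def)
  note mem = mem_Union_cycle_sets_iff[OF \<alpha> finite_atLeastAtMost]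
  have "\<Union>(?C - E') = {1..n} - \<Union>E'"
  proof (rule Set.set_eqI)
    show "i \<in> \<Union>(?C - E') \<longleftrightarrow> i \<in> {1..n} - \<Union>E'" for i
      unfolding Diff_iff mem[OF E] mem[OF Diff_subset] by (auto simp: cycle_sets_def)
  qed
  moreover have "inv' (perm_restrict \<alpha> (\<Union>E')) = perm_restrict (inv' \<alpha>) (\<Union>E')"
    using Union_cycle_sets_closed_iff[OF \<alpha> _ E] permutes_bij[OF \<alpha>]
    by (intro inv_perm_restrict) auto
  ultimately show ?thesis
    using cycle_product_eq[OF \<alpha> _ E] cycle_product_eq[OF \<alpha>, of "?C - E'"]
    by (simp add: partial_dual_def Let_def hyperedges_def)
qed

section \<open>The local conditions\<close>

text \<open>The invariance condition at \<open>k\<close> is the one on \<open>\<sigma>\<inverse>(i)\<close> at \<open>i = \<sigma>(k)\<close> if \<open>\<sigma>(k)\<close> lies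
  off \<open>A\<close>, and the one on \<open>\<sigma>\<inverse>(\<alpha>(i))\<close> at \<open>i = \<alpha>\<inverse>(\<sigma>(k))\<close> if it lies on \<open>A\<close>. Given invariance,
  the flipping condition at \<open>i\<close> supplies the inequality that remains.\<close>

lemma dart_coloring_iff_corner_conditions:
  fixes x :: "'d \<Rightarrow> bool"
  assumes \<sigma>: "\<sigma> permutes S" and \<alpha>: "\<alpha> permutes S"
    and A: "\<And>i. \<alpha> i \<in> A \<longleftrightarrow> i \<in> A"
  shows "(\<forall>i\<in>S. x ((perm_restrict (inv' \<alpha>) A \<circ> \<sigma>) i) = x i \<and>
        x ((perm_restrict (inv' \<alpha>) A \<circ> perm_restrict \<alpha> (S - A)) i) \<noteq> x i) \<longleftrightarrow>
    (\<forall>i\<in>S. if i \<in> A then x (inv' \<sigma> i) \<noteq> x i \<and> x (inv' \<sigma> (\<alpha> i)) = x i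
            else x (inv' \<sigma> i) = x i \<and> x (inv' \<sigma> (\<alpha> i)) \<noteq> x i)"
    (is "?L \<longleftrightarrow> ?R")
proof -
  have inv: "\<sigma> (inv' \<sigma> i) = i" "inv' \<sigma> (\<sigma> i) = i" "\<alpha> (inv' \<alpha> i) = i" "inv' \<alpha> (\<alpha> i) = i" for i
    using \<sigma> \<alpha> permutes_inverses by metis+
  have S: "\<sigma> i \<in> S \<longleftrightarrow> i \<in> S" "\<alpha> i \<in> S \<longleftrightarrow> i \<in> S" "inv' \<sigma> i \<in> S \<longleftrightarrow> i \<in> S"
    "inv' \<alpha> i \<in> S \<longleftrightarrow> i \<in> S" for i
    using \<sigma> \<alpha> permutes_in_image permutes_inv by metis+
  have A': "inv' \<alpha> i \<in> A \<longleftrightarrow> i \<in> A" for i using A inv by metis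
  have L: "?L \<longleftrightarrow> (\<forall>i\<in>S. x (if \<sigma> i \<in> A then inv' \<alpha> (\<sigma> i) else \<sigma> i) = x i \<and>
      x (if i \<in> A then inv' \<alpha> i else \<alpha> i) \<noteq> x i)"
    using A by (intro ball_cong refl) (simp add: perm_restrict_def)
  show ?thesis
    unfolding L
  proof
    assume l: "\<forall>i\<in>S. x (if \<sigma> i \<in> A then inv' \<alpha> (\<sigma> i) else \<sigma> i) = x i \<and>
      x (if i \<in> A then inv' \<alpha> i else \<alpha> i) \<noteq> x i"
    show ?R
    proof
      fix i assume i: "i \<in> S"
      show "if i \<in> A then x (inv' \<sigma> i) \<noteq> x i \<and> x (inv' \<sigma> (\<alpha> i)) = x i
            else x (inv' \<sigma> i) = x i \<and> x (inv' \<sigma> (\<alpha> i)) \<noteq> x i"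
        using bspec[OF l, of i] bspec[OF l, of "inv' \<sigma> i"] bspec[OF l, of "inv' \<sigma> (\<alpha> i)"] i
        by (cases "i \<in> A") (simp_all add: inv S A)
    qed
  next
    assume r: ?R
    show "\<forall>i\<in>S. x (if \<sigma> i \<in> A then inv' \<alpha> (\<sigma> i) else \<sigma> i) = x i \<and>
      x (if i \<in> A then inv' \<alpha> i else \<alpha> i) \<noteq> x i"
    proof
      fix i assume i: "i \<in> S"
      have "x (if \<sigma> i \<in> A then inv' \<alpha> (\<sigma> i) else \<sigma> i) = x i"
        using bspec[OF r, of "\<sigma> i"] bspec[OF r, of "inv' \<alpha> (\<sigma> i)"] i
        by (cases "\<sigma> i \<in> A") (simp_all add: inv S A')
      moreover have "x (if i \<in> A then inv' \<alpha> i else \<alpha> i) \<noteq> x i"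
        using bspec[OF r, of i] bspec[OF r, of "inv' \<alpha> i"] bspec[OF r, of "\<alpha> i"] i
        by (cases "i \<in> A") (simp_all add: inv S A A')
      ultimately show "x (if \<sigma> i \<in> A then inv' \<alpha> (\<sigma> i) else \<sigma> i) = x i \<and>
        x (if i \<in> A then inv' \<alpha> i else \<alpha> i) \<noteq> x i" by blast
    qed
  qed
qed

section \<open>Directions as colorings of darts\<close>

context
  fixes n :: nat and \<sigma> \<alpha> :: "nat \<Rightarrow> nat"
  assumes H: "connected_hypermap n (\<sigma>, \<alpha>)"
begin

private lemma perms: "\<sigma> permutes {1..n}" "\<alpha> permutes {1..n}"
  using H by (auto simp: connected_hypermap_def)

lemma medial_edge_of_eq:
  assumes i: "i \<in> {1..n}"
  shows "medial_edge_of n (\<sigma>, \<alpha>) (Plus i) = {Plus i, Minus (\<sigma> i)}"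
    and "medial_edge_of n (\<sigma>, \<alpha>) (Minus (\<sigma> i)) = {Plus i, Minus (\<sigma> i)}"
proof -
  let ?f = "snd (medial_map n (\<sigma>, \<alpha>))"
  have "finite (half_edges n)" by (simp add: half_edges_def)
  then have "permutation ?f"
    using medial_map_permutes(2)[OF H] by (auto simp: permutation_permutes)
  then have self: "h \<in> medial_edge_of n (\<sigma>, \<alpha>) h" for h
    by (simp add: medial_edge_of_def permutation_self_in_orbit)
  have mem: "medial_edge_of n (\<sigma>, \<alpha>) h \<in> (\<lambda>i. {Plus i, Minus (\<sigma> i)}) ` {1..n}"
    if "h \<in> half_edges n" for h
    using that medial_edges_eq[OF H]
    by (auto simp: medial_edges_def cycle_sets_def medial_edge_of_def)
  have "Plus i \<in> half_edges n" using i by simp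
  from mem[OF this] obtain k where k: "medial_edge_of n (\<sigma>, \<alpha>) (Plus i) = {Plus k, Minus (\<sigma> k)}"
    by (elim imageE) (rule that)
  moreover have "i = k" using k self[of "Plus i"] by simp
  ultimately show "medial_edge_of n (\<sigma>, \<alpha>) (Plus i) = {Plus i, Minus (\<sigma> i)}" by simp
  have "Minus (\<sigma> i) \<in> half_edges n" using i permutes_in_image[OF perms(1)] by simp
  from mem[OF this] obtain k where k: "medial_edge_of n (\<sigma>, \<alpha>) (Minus (\<sigma> i)) = {Plus k, Minus (\<sigma> k)}"
    by (elim imageE) (rule that)
  then have "\<sigma> i = \<sigma> k" using self[of "Minus (\<sigma> i)"] by simp
  then have "i = k" using permutes_inj[OF perms(1)] by (simp add: inj_eq)
  with k show "medial_edge_of n (\<sigma>, \<alpha>) (Minus (\<sigma> i)) = {Plus i, Minus (\<sigma> i)}" by simp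
qed

lemma directed_iff:
  assumes \<Phi>: "direction n (\<sigma>, \<alpha>) \<Phi>" and i: "i \<in> {1..n}"
  shows "directed_in n (\<sigma>, \<alpha>) \<Phi> (Plus i) \<longleftrightarrow> \<not> directed_out n (\<sigma>, \<alpha>) \<Phi> (Plus i)"
    and "directed_in n (\<sigma>, \<alpha>) \<Phi> (Minus i) \<longleftrightarrow> directed_out n (\<sigma>, \<alpha>) \<Phi> (Plus (inv' \<sigma> i))"
    and "directed_out n (\<sigma>, \<alpha>) \<Phi> (Minus i) \<longleftrightarrow> \<not> directed_out n (\<sigma>, \<alpha>) \<Phi> (Plus (inv' \<sigma> i))"
proof -
  have ends: "{Plus j, Minus (\<sigma> j)} =
      {fst (\<Phi> {Plus j, Minus (\<sigma> j)}), snd (\<Phi> {Plus j, Minus (\<sigma> j)})}"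
    if "j \<in> {1..n}" for j
    using \<Phi> that by (auto simp: direction_def medial_edges_eq[OF H])
  show "directed_in n (\<sigma>, \<alpha>) \<Phi> (Plus i) \<longleftrightarrow> \<not> directed_out n (\<sigma>, \<alpha>) \<Phi> (Plus i)"
    using ends[OF i] by (auto simp: directed_in_def directed_out_def medial_edge_of_eq[OF i] doubleton_eq_iff)
  define j where "j = inv' \<sigma> i"
  have j: "j \<in> {1..n}" "i = \<sigma> j"
    using i perms(1) permutes_in_image permutes_inv permutes_inverses(1) unfolding j_def by metis+
  have "directed_in n (\<sigma>, \<alpha>) \<Phi> (Minus i) \<longleftrightarrow> directed_out n (\<sigma>, \<alpha>) \<Phi> (Plus j)"
    and "directed_out n (\<sigma>, \<alpha>) \<Phi> (Minus i) \<longleftrightarrow> \<not> directed_out n (\<sigma>, \<alpha>) \<Phi> (Plus j)"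
    using ends[OF j(1)] unfolding j(2)
    by (auto simp: directed_in_def directed_out_def medial_edge_of_eq[OF j(1)] doubleton_eq_iff)
  then show "directed_in n (\<sigma>, \<alpha>) \<Phi> (Minus i) \<longleftrightarrow> directed_out n (\<sigma>, \<alpha>) \<Phi> (Plus (inv' \<sigma> i))"
    and "directed_out n (\<sigma>, \<alpha>) \<Phi> (Minus i) \<longleftrightarrow>
      \<not> directed_out n (\<sigma>, \<alpha>) \<Phi> (Plus (inv' \<sigma> i))"
    unfolding j_def .
qed

lemma exists_direction:
  "\<exists>\<Phi>. direction n (\<sigma>, \<alpha>) \<Phi> \<and> (\<forall>i\<in>{1..n}. directed_out n (\<sigma>, \<alpha>) \<Phi> (Plus i) = x i)"
proof -
  define \<Phi> where "\<Phi> m = (let i = (THE i. Plus i \<in> m) in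
    if x i then (Plus i, Minus (\<sigma> i)) else (Minus (\<sigma> i), Plus i))" for m
  have \<Phi>: "\<Phi> {Plus i, Minus (\<sigma> i)} =
      (if x i then (Plus i, Minus (\<sigma> i)) else (Minus (\<sigma> i), Plus i))" for i
    by (simp add: \<Phi>_def Let_def)
  have "direction n (\<sigma>, \<alpha>) \<Phi>"
    by (auto simp: direction_def medial_edges_eq[OF H] \<Phi>)
  moreover have "directed_out n (\<sigma>, \<alpha>) \<Phi> (Plus i) = x i" if "i \<in> {1..n}" for i
    by (simp add: directed_out_def medial_edge_of_eq[OF that] \<Phi>)
  ultimately show ?thesis by blast
qed

context
  fixes \<Phi> :: edge_direction and x :: "nat \<Rightarrow> bool" and e :: "nat set"
  assumes \<Phi>: "direction n (\<sigma>, \<alpha>) \<Phi>"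
    and x: "\<And>i. i \<in> {1..n} \<Longrightarrow> directed_out n (\<sigma>, \<alpha>) \<Phi> (Plus i) = x i"
    and e: "e \<in> hyperedges n (\<sigma>, \<alpha>)"
begin

private lemma corner_iff:
  assumes i: "i \<in> e"
  shows "source_sink n (\<sigma>, \<alpha>) \<Phi> (Minus i, Plus i) \<longleftrightarrow> x (inv' \<sigma> i) \<noteq> x i"
    and "source_sink n (\<sigma>, \<alpha>) \<Phi> (Plus i, Minus (\<alpha> i)) \<longleftrightarrow> x (inv' \<sigma> (\<alpha> i)) \<noteq> x i"
proof -
  have "e \<subseteq> {1..n}"
    using e permutes_orbit_subset[OF perms(2)] unfolding hyperedges_def cycle_sets_def snd_conv by blast
  then have D: "i \<in> {1..n}" "\<alpha> i \<in> {1..n}" "inv' \<sigma> i \<in> {1..n}" "inv' \<sigma> (\<alpha> i) \<in> {1..n}"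
    using i perms permutes_in_image permutes_inv by (metis subsetD)+
  show "source_sink n (\<sigma>, \<alpha>) \<Phi> (Minus i, Plus i) \<longleftrightarrow> x (inv' \<sigma> i) \<noteq> x i"
    and "source_sink n (\<sigma>, \<alpha>) \<Phi> (Plus i, Minus (\<alpha> i)) \<longleftrightarrow> x (inv' \<sigma> (\<alpha> i)) \<noteq> x i"
    by (auto simp: source_sink_def directed_iff[OF \<Phi> D(1)] directed_iff[OF \<Phi> D(2)]
        x[OF D(1)] x[OF D(3)] x[OF D(4)])
qed

lemma type_c_iff:
  "type_c n (\<sigma>, \<alpha>) \<Phi> (medial_vertex e) \<longleftrightarrow>
    (\<forall>i\<in>e. x (inv' \<sigma> i) \<noteq> x i \<and> x (inv' \<sigma> (\<alpha> i)) = x i)"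
  using corner_iff by (auto simp: type_c_def crossing_def medial_corners_eq[OF H e])

lemma type_d_iff:
  "type_d n (\<sigma>, \<alpha>) \<Phi> (medial_vertex e) \<longleftrightarrow>
    (\<forall>i\<in>e. x (inv' \<sigma> i) = x i \<and> x (inv' \<sigma> (\<alpha> i)) \<noteq> x i)"
  using corner_iff by (auto simp: type_d_def crossing_def medial_corners_eq[OF H e])

end

text \<open>Since hyperedges are nonempty, no vertex is of both types, so that prescribing the type-c
  set as \<open>E'\<close> amounts to prescribing type c on \<open>E'\<close> and type d elsewhere.\<close>

lemma all_crossing_iff_corner_conditions:
  assumes \<Phi>: "direction n (\<sigma>, \<alpha>) \<Phi>"
    and x: "\<And>i. i \<in> {1..n} \<Longrightarrow> directed_out n (\<sigma>, \<alpha>) \<Phi> (Plus i) = x i"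
    and E': "E' \<subseteq> hyperedges n (\<sigma>, \<alpha>)"
  shows "all_crossing n (\<sigma>, \<alpha>) \<Phi> \<and> E' = type_c_hyperedges n (\<sigma>, \<alpha>) \<Phi> \<longleftrightarrow>
    (\<forall>i\<in>{1..n}. if i \<in> \<Union>E' then x (inv' \<sigma> i) \<noteq> x i \<and> x (inv' \<sigma> (\<alpha> i)) = x i
                 else x (inv' \<sigma> i) = x i \<and> x (inv' \<sigma> (\<alpha> i)) \<noteq> x i)"
    (is "?L \<longleftrightarrow> (\<forall>i\<in>{1..n}. ?R i)")
proof -
  let ?E = "hyperedges n (\<sigma>, \<alpha>)"
  let ?c = "\<lambda>e. type_c n (\<sigma>, \<alpha>) \<Phi> (medial_vertex e)"
  let ?d = "\<lambda>e. type_d n (\<sigma>, \<alpha>) \<Phi> (medial_vertex e)"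
  have c: "?c e \<longleftrightarrow> (\<forall>i\<in>e. x (inv' \<sigma> i) \<noteq> x i \<and> x (inv' \<sigma> (\<alpha> i)) = x i)"
    and d: "?d e \<longleftrightarrow> (\<forall>i\<in>e. x (inv' \<sigma> i) = x i \<and> x (inv' \<sigma> (\<alpha> i)) \<noteq> x i)"
    if "e \<in> ?E" for e
    using that type_c_iff[OF \<Phi> x] type_d_iff[OF \<Phi> x] by blast+
  have E_cycles: "?E = cycle_sets \<alpha> {1..n}" by (simp add: hyperedges_def)
  note mem = mem_Union_cycle_sets_iff[OF perms(2) finite_atLeastAtMost, folded E_cycles]
  have UE: "\<Union>?E = {1..n}"
  proof (rule Set.set_eqI)
    show "i \<in> \<Union>?E \<longleftrightarrow> i \<in> {1..n}" for i
      unfolding mem[OF subset_refl] by (auto simp: E_cycles cycle_sets_def)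
  qed
  have e_eq: "orbit \<alpha> i = e" if "e \<in> ?E" "i \<in> e" for e i
    using mem[of "{e}"] that by auto
  have E'_iff: "i \<in> \<Union>E' \<longleftrightarrow> e \<in> E'" if "e \<in> ?E" "i \<in> e" for e i
    using that e_eq E' by blast
  have ne: "e \<noteq> {}" if "e \<in> ?E" for e
    using that by (auto simp: E_cycles cycle_sets_def orbit_nonempty)
  have excl: "\<not> (?c e \<and> ?d e)" if "e \<in> ?E" for e
    using c[OF that] d[OF that] ne[OF that] by blast
  have "?L \<longleftrightarrow> (\<forall>e\<in>?E. (?c e \<and> \<not> ?d e) \<or> (?d e \<and> \<not> ?c e)) \<and> (\<forall>e\<in>?E. e \<in> E' \<longleftrightarrow> ?c e)"
    using \<Phi> E' by (auto simp: all_crossing_def medial_vertices_eq[OF H] type_c_hyperedges_def)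
  also have "\<dots> \<longleftrightarrow> (\<forall>e\<in>?E. if e \<in> E' then ?c e else ?d e)"
    using excl by (auto split: if_splits)
  also have "\<dots> \<longleftrightarrow> (\<forall>e\<in>?E. \<forall>i\<in>e. ?R i)"
  proof (rule ball_cong[OF refl])
    fix e assume e: "e \<in> ?E"
    show "(if e \<in> E' then ?c e else ?d e) \<longleftrightarrow> (\<forall>i\<in>e. ?R i)"
      using c[OF e] d[OF e] E'_iff[OF e] by (cases "e \<in> E'") simp_all
  qed
  also have "\<dots> \<longleftrightarrow> (\<forall>i\<in>{1..n}. ?R i)"
    unfolding UE[symmetric] by blast
  finally show ?thesis .
qed

end

section \<open>Bipartite partial duals and all-crossing directions\<close>

theorem theorem6p5:
  fixes n :: nat
    and \<sigma> \<alpha> :: "nat \<Rightarrow> nat"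
    and E' :: "nat set set"
  assumes "connected_hypermap n (\<sigma>, \<alpha>)"
    and "E' \<subseteq> hyperedges n (\<sigma>, \<alpha>)"
  shows "bipartite n (partial_dual n (\<sigma>, \<alpha>) E') \<longleftrightarrow>
    (\<exists>\<Phi>. all_crossing n (\<sigma>, \<alpha>) \<Phi> \<and> E' = type_c_hyperedges n (\<sigma>, \<alpha>) \<Phi>)"
proof -
  let ?A = "\<Union>E'"
  let ?s = "perm_restrict (inv' \<alpha>) ?A \<circ> \<sigma>"
  let ?a = "perm_restrict (inv' \<alpha>) ?A \<circ> perm_restrict \<alpha> ({1..n} - ?A)"
  let ?R = "\<lambda>(x :: nat \<Rightarrow> bool) i. if i \<in> ?A then x (inv' \<sigma> i) \<noteq> x i \<and> x (inv' \<sigma> (\<alpha> i)) = x i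
                 else x (inv' \<sigma> i) = x i \<and> x (inv' \<sigma> (\<alpha> i)) \<noteq> x i"
  have perms: "\<sigma> permutes {1..n}" "\<alpha> permutes {1..n}"
    using assms(1) by (auto simp: connected_hypermap_def)
  have E: "E' \<subseteq> cycle_sets \<alpha> {1..n}" using assms(2) by (simp add: hyperedges_def)
  have A: "\<alpha> i \<in> ?A \<longleftrightarrow> i \<in> ?A" for i
    by (rule Union_cycle_sets_closed_iff[OF perms(2) finite_atLeastAtMost E])
  have inv_A: "inv' \<alpha> i \<in> ?A \<longleftrightarrow> i \<in> ?A" for i
    using A permutes_inverses(1)[OF perms(2)] by metis
  have s: "?s permutes {1..n}" and a: "?a permutes {1..n}"
    using A inv_A permutes_in_image[OF perms(2)]
    by (intro permutes_compose perm_restrict_permutes perms permutes_inv; simp)+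
  have "bipartite n (partial_dual n (\<sigma>, \<alpha>) E') \<longleftrightarrow> (\<exists>x. \<forall>i\<in>{1..n}. ?R x i)"
    unfolding partial_dual_eq[OF perms(2) assms(2)] bipartite_iff_dart_coloring[OF s a]
    using dart_coloring_iff_corner_conditions[OF perms A] by simp
  also have "\<dots> \<longleftrightarrow> (\<exists>\<Phi>. all_crossing n (\<sigma>, \<alpha>) \<Phi> \<and> E' = type_c_hyperedges n (\<sigma>, \<alpha>) \<Phi>)"
  proof
    assume "\<exists>x. \<forall>i\<in>{1..n}. ?R x i"
    then obtain x where x: "\<forall>i\<in>{1..n}. ?R x i" ..
    obtain \<Phi> where \<Phi>: "direction n (\<sigma>, \<alpha>) \<Phi>"
      and out: "\<forall>i\<in>{1..n}. directed_out n (\<sigma>, \<alpha>) \<Phi> (Plus i) = x i"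
      using exists_direction[OF assms(1), of x] by (elim exE conjE) (rule that)
    have "all_crossing n (\<sigma>, \<alpha>) \<Phi> \<and> E' = type_c_hyperedges n (\<sigma>, \<alpha>) \<Phi>"
      using all_crossing_iff_corner_conditions[OF assms(1) \<Phi> bspec[OF out] assms(2)] x
      by (simp only:)
    then show "\<exists>\<Phi>. all_crossing n (\<sigma>, \<alpha>) \<Phi> \<and> E' = type_c_hyperedges n (\<sigma>, \<alpha>) \<Phi>"
      by (intro exI[of _ \<Phi>])
  next
    assume "\<exists>\<Phi>. all_crossing n (\<sigma>, \<alpha>) \<Phi> \<and> E' = type_c_hyperedges n (\<sigma>, \<alpha>) \<Phi>"
    then obtain \<Phi>
      where \<Phi>: "all_crossing n (\<sigma>, \<alpha>) \<Phi> \<and> E' = type_c_hyperedges n (\<sigma>, \<alpha>) \<Phi>" ..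
    then have dir: "direction n (\<sigma>, \<alpha>) \<Phi>" by (simp add: all_crossing_def)
    define x where "x i = directed_out n (\<sigma>, \<alpha>) \<Phi> (Plus i)" for i
    have "\<forall>i\<in>{1..n}. ?R x i"
      using all_crossing_iff_corner_conditions[OF assms(1) dir x_def[symmetric] assms(2)] \<Phi>
      by (rule iffD1)
    then show "\<exists>x. \<forall>i\<in>{1..n}. ?R x i" by (intro exI[of _ x])
  qed
  finally show ?thesis .
qed

end
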